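(* Let $P_0=0$, $P_1=1$, $P_{n+2}=2P_{n+1}+P_n$ be the Pell numbers and suppose the move costs are $w_{n,k}=\alpha_n=P_{n+1}$ for all $n\in\mathbb{N}_0$ and all $k\in T=\{0,1,2\}$. Let $t_n$ denote the common value $d_{n,0}=d_{n,1}=d_{n,2}$ of the minimal costs. Then for all $n\in\mathbb{N}_0$, $$t_n=P_{n+2}-2^{n+1}.$$ Moreover, $(t_n)$ satisfies the order-$3$ recurrence $$t_0=0,\ t_1=1,\ t_2=4,\qquad t_{n+3}=4t_{n+2}-3t_{n+1}-2t_n\quad(n\in\mathbb{N}_0).$$
   Context: Weighted Tower of Hanoi: $\mathbb{N}_0$ denotes the nonnegative integers; $T=\{0,1,2\}$ is the set of pegs; discs are labelled $1,2,3,\dots$ by increasing size. A state with $n$ discs is an assignment of the discs $1,\dots,n$ to the pegs, the discs on each peg being stacked with smaller discs above larger ones. A legal move transfers the topmost (smallest) disc of one peg to a different peg carrying no smaller disc. For $i\in T$, $i^n$ is the perfect state with all $n$ discs on peg $i$. For $\{i,j,k\}=T$ and $n\in\mathbb{N}_0$, $w_{n,k}\in[0,\infty)$ is a given cost of a single move of disc $n+1$ between pegs $i$ and $j$ (in either direction), and $d_{n,k}$ is the minimal total cost, over all finite sequences of legal moves, of getting from $i^n$ to $j^n$ with $n$ discs. When the costs do not depend on $k$, the values $d_{n,0},d_{n,1},d_{n,2}$ coincide. *)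

theory Defs
  imports Complex_Main "HOL-Library.FuncSet"
begin

definition pegs :: "nat set" where
  "pegs = {0, 1, 2}"

text \<open>
  A state assigns discs \<open>1, \<dots>, n\<close> to pegs. Since the discs on a peg are always sorted by size,
  this assignment determines the stacks. States are extensional, so there is exactly one state
  with no discs.
\<close>

definition states :: "nat \<Rightarrow> (nat \<Rightarrow> nat) set" where
  "states n = {1..n} \<rightarrow>\<^sub>E pegs"

definition perfect :: "nat \<Rightarrow> nat \<Rightarrow> nat \<Rightarrow> nat" where
  "perfect n i = (\<lambda>m\<in>{1..n}. i)"

definition legal_move ::
  "nat \<Rightarrow> nat \<Rightarrow> nat \<Rightarrow> nat \<Rightarrow> (nat \<Rightarrow> nat) \<Rightarrow> (nat \<Rightarrow> nat) \<Rightarrow> bool" where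
  "legal_move n m i j s s' \<longleftrightarrow>
     s \<in> states n \<and> m \<in> {1..n} \<and> i \<in> pegs \<and> j \<in> pegs \<and> i \<noteq> j \<and>
     s m = i \<and>
     (\<forall>l\<in>{1..n}. s l = i \<longrightarrow> m \<le> l) \<and>
     (\<forall>l\<in>{1..n}. s l = j \<longrightarrow> m \<le> l) \<and>
     s' = s(m := j)"

text \<open>
  \<open>route w n s c s'\<close>: some finite sequence of legal moves of total cost \<open>c\<close> leads from \<open>s\<close> to \<open>s'\<close>.
  The cost of moving disc \<open>m + 1\<close> between two pegs is \<open>w m k\<close>, where \<open>k\<close> is the remaining peg;
  the condition \<open>{i, j, k} = pegs\<close> forces \<open>i\<close>, \<open>j\<close>, \<open>k\<close> to be distinct.
\<close>

inductive route ::
  "(nat \<Rightarrow> nat \<Rightarrow> real) \<Rightarrow> nat \<Rightarrow> (nat \<Rightarrow> nat) \<Rightarrow> real \<Rightarrow> (nat \<Rightarrow> nat) \<Rightarrow> bool"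
  for w :: "nat \<Rightarrow> nat \<Rightarrow> real" and n :: nat and s :: "nat \<Rightarrow> nat" where
  stay: "s \<in> states n \<Longrightarrow> route w n s 0 s"
| step: "route w n s c s' \<Longrightarrow> legal_move n (Suc m) i j s' s'' \<Longrightarrow> {i, j, k} = pegs
           \<Longrightarrow> route w n s (c + w m k) s''"

definition is_min_cost :: "(nat \<Rightarrow> nat \<Rightarrow> real) \<Rightarrow> nat \<Rightarrow> nat \<Rightarrow> real \<Rightarrow> bool" where
  "is_min_cost w n k c \<longleftrightarrow>
     (\<forall>i j. {i, j, k} = pegs \<longrightarrow>
        route w n (perfect n i) c (perfect n j) \<and>
        (\<forall>c'. route w n (perfect n i) c' (perfect n j) \<longrightarrow> c \<le> c'))"

text \<open>
  The minimum does not depend on which of the two pegs other than \<open>k\<close> is the starting peg,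
  because moves are reversible at the same cost.
\<close>

definition min_cost :: "(nat \<Rightarrow> nat \<Rightarrow> real) \<Rightarrow> nat \<Rightarrow> nat \<Rightarrow> real" where
  "min_cost w n k = (THE c. is_min_cost w n k c)"

fun pell :: "nat \<Rightarrow> nat" where
  "pell 0 = 0"
| "pell (Suc 0) = 1"
| "pell (Suc (Suc n)) = 2 * pell (Suc n) + pell n"

end

theory Submission
  imports Defs
begin

text \<open>
  The costs depend only on the disc, so let \<open>a m \<ge> 0\<close> be the cost of moving disc \<open>m + 1\<close>. The
  classical strategy is then optimal: clear the \<open>n\<close> smaller discs to the auxiliary peg, move
  disc \<open>n + 1\<close> once, and bring the smaller discs back on top of it. Its cost \<open>h n\<close>
  for \<open>n\<close> discs (\<open>hanoi_cost a n\<close>) satisfies \<open>h 0 = 0\<close> and \<open>h (n + 1) = 2 * h n + a n\<close>,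
  and for \<open>a m = P\<^bsub>m+1\<^esub>\<close> this solves to
  \<open>P\<^bsub>n+2\<^esub> - 2\<^bsup>n+1\<^esup>\<close>. The third-order recurrence has characteristic polynomial
  \<open>(x - 2) * (x\<^sup>2 - 2 * x - 1)\<close>, the first factor annihilating the powers
  of two and the second the Pell numbers.

  Optimality is shown without decomposing routes at the moves of the largest disc. The
  function \<open>potential a n s q\<close> is the cost of gathering all discs of the state \<open>s\<close> on peg \<open>q\<close> by
  the strategy in which the largest disc that is not on \<open>q\<close> moves only once. A single legal
  move lowers this potential by at most its own cost (\<open>potential_move\<close>), so every route
  from a perfect state to a different one, on peg \<open>q\<close>, costs at least the potential of its starting state, which
  is \<open>h n\<close> (\<open>potential_perfect\<close>), because the final state has potential \<open>0\<close>.
  The matching route is built in \<open>route_perfect\<close>.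
\<close>

fun hanoi_cost :: "(nat \<Rightarrow> real) \<Rightarrow> nat \<Rightarrow> real" where
  "hanoi_cost a 0 = 0"
| "hanoi_cost a (Suc n) = 2 * hanoi_cost a n + a n"

text \<open>
  If disc \<open>n + 1\<close> lies on the wrong peg \<open>p\<close>, the others must first gather
  on the third peg, which is \<open>3 - p - q\<close> because the three pegs sum to \<open>3\<close>; once the largest
  disc has moved, they form a perfect tower that is transferred at cost \<open>hanoi_cost a n\<close>.
\<close>

fun potential :: "(nat \<Rightarrow> real) \<Rightarrow> nat \<Rightarrow> (nat \<Rightarrow> nat) \<Rightarrow> nat \<Rightarrow> real" where
  "potential a 0 s q = 0"
| "potential a (Suc n) s q =
     (if s (Suc n) = q then potential a n s q
      else potential a n s (3 - s (Suc n) - q) + a n + hanoi_cost a n)"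

lemma pegs_distinct:
  assumes "{i, j, k} = pegs"
  shows "i \<noteq> j \<and> k \<noteq> i \<and> k \<noteq> j"
proof -
  have "card {i, j, k} = 3" using assms by (simp add: pegs_def)
  then show ?thesis by (auto simp: card_insert_if split: if_splits)
qed

lemma third_peg_in_pegs: "i \<in> pegs \<Longrightarrow> j \<in> pegs \<Longrightarrow> i \<noteq> j \<Longrightarrow> 3 - i - j \<in> pegs"
  by (auto simp: pegs_def)

lemma potential_cong:
  "(\<And>l. l \<in> {1..n} \<Longrightarrow> s l = s' l) \<Longrightarrow> potential a n s q = potential a n s' q"
  by (induction n arbitrary: q) auto

lemma potential_constant:
  assumes "\<And>l. l \<in> {1..n} \<Longrightarrow> s l = i" "i \<in> pegs" "q \<in> pegs"
  shows "potential a n s q = (if i = q then 0 else hanoi_cost a n)"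
  using assms
proof (induction n arbitrary: q)
  case (Suc n)
  have third: "i \<noteq> q \<Longrightarrow> 3 - i - q \<in> pegs \<and> 3 - i - q \<noteq> i"
    using Suc.prems(2,3) by (auto simp: pegs_def)
  have "potential a n s q' = (if i = q' then 0 else hanoi_cost a n)" if "q' \<in> pegs" for q'
    using Suc.IH[of q'] Suc.prems that by auto
  then show ?case
    using third Suc.prems by (auto split: if_splits)
qed simp

lemma potential_perfect:
  assumes "i \<in> pegs" "q \<in> pegs"
  shows "potential a n (perfect n i) q = (if i = q then 0 else hanoi_cost a n)"
  by (rule potential_constant) (use assms in \<open>auto simp: perfect_def\<close>)

text \<open>
  The potential is Lipschitz along moves. A move of a smaller disc is handled by the induction
  hypothesis, applied to whichever peg the smaller discs are to gather on. When the largest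
  disc moves from \<open>i\<close> to \<open>j\<close>, all smaller discs form a perfect tower on the third peg, so both
  potentials are explicit. The induction needs the rule of the game in a form that survives
  forgetting the largest disc, which \<open>legal_move\<close> with its extensional states does not.
\<close>

lemma potential_move:
  assumes "\<And>m. a m \<ge> 0" "m < n" "\<And>l. l \<in> {1..n} \<Longrightarrow> s l \<in> pegs"
    and "s (Suc m) = i" "j \<in> pegs" "i \<noteq> j" "q \<in> pegs"
    and "\<And>l. l \<in> {1..n} \<Longrightarrow> s l = i \<or> s l = j \<Longrightarrow> Suc m \<le> l"
  shows "potential a n s q \<le> a m + potential a n (s(Suc m := j)) q"
  using assms(2,3,7,8)
proof (induction n arbitrary: q)
  case (Suc n)
  have top: "s (Suc n) \<in> pegs" using Suc.prems(2) by simp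
  show ?case
  proof (cases "m = n")
    case False
    then have "m < n" using Suc.prems(1) by simp
    have IH: "potential a n s q' \<le> a m + potential a n (s(Suc m := j)) q'" if "q' \<in> pegs" for q'
      by (rule Suc.IH) (use Suc.prems \<open>m < n\<close> that in auto)
    have "(s(Suc m := j)) (Suc n) = s (Suc n)" using \<open>m < n\<close> by simp
    then show ?thesis
      using IH[OF Suc.prems(3)] IH[OF third_peg_in_pegs[OF top Suc.prems(3)]]
      by (simp del: fun_upd_apply)
  next
    case True
    have i: "i \<in> pegs" using top True assms(4) by simp
    have tower: "s l = 3 - i - j" if "l \<in> {1..n}" for l
    proof -
      have "s l \<in> pegs" using Suc.prems(2) that by simp
      moreover have "s l \<noteq> i" "s l \<noteq> j" using Suc.prems(4)[of l] that True by auto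
      ultimately show ?thesis using i assms(5,6) by (auto simp: pegs_def)
    qed
    have pot: "potential a n s q' = (if 3 - i - j = q' then 0 else hanoi_cost a n)"
      if "q' \<in> pegs" for q'
      by (rule potential_constant) (use tower that third_peg_in_pegs i assms(5,6) in auto)
    have pot': "potential a n (s(Suc n := p)) q' = potential a n s q'" for p q'
      by (rule potential_cong) auto
    show ?thesis
      using i assms(4-6) Suc.prems(3) True assms(1)[of n]
      by (auto simp: pot pot' pegs_def fun_upd_same simp del: fun_upd_apply)
  qed
qed simp

lemma route_cost_ge_potential_drop:
  assumes "route w n s c s'" "\<And>m k. k \<in> pegs \<Longrightarrow> w m k = a m" "\<And>m. a m \<ge> 0" "q \<in> pegs"
  shows "potential a n s q \<le> c + potential a n s' q"
  using assms(1)
proof (induction rule: route.induct)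
  case (step c s' m i j s'' k)
  have "k \<in> pegs" using step.hyps(3) by blast
  moreover have "potential a n s' q \<le> a m + potential a n s'' q"
  proof -
    have "s'' = s'(Suc m := j)" using step.hyps(2) by (simp add: legal_move_def)
    moreover have "potential a n s' q \<le> a m + potential a n (s'(Suc m := j)) q"
      by (rule potential_move[where i = i])
        (use step.hyps(2) assms(3,4) in \<open>auto simp: legal_move_def states_def PiE_iff\<close>)
    ultimately show ?thesis by simp
  qed
  ultimately show ?case using step.IH assms(2) by simp
qed simp

lemma route_trans:
  assumes "route w n s c s'" "route w n s' c' s''"
  shows "route w n s (c + c') s''"
  using assms(2,1)
proof (induction rule: route.induct)
  case (step c' x m i j y k)
  then show ?case using route.step[of w n s "c + c'" x m i j y k] by (simp add: add.assoc)
qed simp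

lemma states_Suc: "s \<in> states n \<Longrightarrow> p \<in> pegs \<Longrightarrow> s(Suc n := p) \<in> states (Suc n)"
  by (auto simp: states_def PiE_iff extensional_def)

lemma perfect_in_states: "i \<in> pegs \<Longrightarrow> perfect n i \<in> states n"
  by (auto simp: states_def perfect_def)

lemma perfect_Suc: "perfect (Suc n) i = (perfect n i)(Suc n := i)"
  by (auto simp: perfect_def restrict_def)

text \<open>A larger disc never obstructs the smaller ones.\<close>

lemma route_add_largest_disc:
  assumes "route w n s c s'" "p \<in> pegs"
  shows "route w (Suc n) (s(Suc n := p)) c (s'(Suc n := p))"
  using assms(1)
proof (induction rule: route.induct)
  case stay
  then show ?case using assms(2) by (intro route.stay states_Suc)
next
  case (step c s' m i j s'' k)
  have "legal_move (Suc n) (Suc m) i j (s'(Suc n := p)) (s''(Suc n := p))"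
    using step.hyps(2) assms(2) by (auto simp: legal_move_def intro!: states_Suc fun_upd_twist)
  then show ?case using step.IH step.hyps(3) route.step by blast
qed

lemma legal_move_largest_disc:
  assumes "{i, j, k} = pegs"
  shows "legal_move (Suc n) (Suc n) i j
    ((perfect n k)(Suc n := i)) ((perfect n k)(Suc n := j))"
proof -
  have "i \<in> pegs" "j \<in> pegs" "k \<in> pegs" using assms by blast+
  with pegs_distinct[OF assms] show ?thesis
    by (auto simp: legal_move_def perfect_def states_def PiE_iff extensional_def)
qed

lemma route_perfect:
  assumes "\<And>m k. k \<in> pegs \<Longrightarrow> w m k = a m" "{i, j, k} = pegs"
  shows "route w n (perfect n i) (hanoi_cost a n) (perfect n j)"
  using assms(2)
proof (induction n arbitrary: i j k)
  case 0
  have "i \<in> pegs" using 0 by blast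
  moreover have "perfect 0 j = perfect 0 i" by (simp add: perfect_def restrict_def)
  ultimately show ?case by (simp add: route.stay perfect_in_states)
next
  case (Suc n)
  have p: "i \<in> pegs" "j \<in> pegs" "k \<in> pegs" using Suc.prems by blast+
  have "{i, k, j} = pegs" "{k, j, i} = pegs" using Suc.prems by blast+
  note small = Suc.IH[OF this(1)] Suc.IH[OF this(2)]
  have "route w (Suc n) (perfect (Suc n) i) (hanoi_cost a n + w n k) ((perfect n k)(Suc n := j))"
    using route.step[OF route_add_largest_disc[OF small(1) p(1)]
        legal_move_largest_disc[OF Suc.prems] Suc.prems]
    by (simp add: perfect_Suc)
  from route_trans[OF this route_add_largest_disc[OF small(2) p(2)]]
  show ?case
    using assms(1)[OF p(3)] by (simp add: perfect_Suc algebra_simps del: fun_upd_apply)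
qed

lemma is_min_cost_hanoi_cost:
  assumes "\<And>m k. k \<in> pegs \<Longrightarrow> w m k = a m" "\<And>m. a m \<ge> 0"
  shows "is_min_cost w n k (hanoi_cost a n)"
  unfolding is_min_cost_def
proof (intro allI impI conjI)
  fix i j c
  assume ijk: "{i, j, k} = pegs"
  show "route w n (perfect n i) (hanoi_cost a n) (perfect n j)"
    using route_perfect[OF assms(1) ijk] .
  have p: "i \<in> pegs" "j \<in> pegs" using ijk by blast+
  have "i \<noteq> j" using pegs_distinct[OF ijk] by simp
  assume "route w n (perfect n i) c (perfect n j)"
  from route_cost_ge_potential_drop[OF this assms p(2)]
  show "hanoi_cost a n \<le> c" using p \<open>i \<noteq> j\<close> by (simp add: potential_perfect)
qed

lemma min_cost_eqI:
  assumes "is_min_cost w n k c" "k \<in> pegs"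
  shows "min_cost w n k = c"
  unfolding min_cost_def
proof (rule the_equality[where P = "is_min_cost w n k", OF assms(1)])
  fix c'
  assume c': "is_min_cost w n k c'"
  have "\<exists>i j. {i, j, k} = pegs" using assms(2) by (auto simp: pegs_def)
  then obtain i j where "{i, j, k} = pegs" by blast
  then show "c' = c" using assms(1) c' by (meson is_min_cost_def order_antisym)
qed

lemma hanoi_cost_pell:
  "hanoi_cost (\<lambda>m. real (pell (m + 1))) n = real (pell (n + 2)) - 2 ^ (n + 1)"
  by (induction n) auto

theorem proposition10:
  fixes w :: "nat \<Rightarrow> nat \<Rightarrow> real" and t :: "nat \<Rightarrow> real"
  assumes w: "\<And>n k. k \<in> pegs \<Longrightarrow> w n k = real (pell (n + 1))"
    and t: "\<And>n. t n = min_cost w n 0"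
  shows "(\<forall>n. \<forall>k\<in>pegs. is_min_cost w n k (t n) \<and> min_cost w n k = t n) \<and>
    (\<forall>n. t n = real (pell (n + 2)) - 2 ^ (n + 1)) \<and>
    t 0 = 0 \<and> t 1 = 1 \<and> t 2 = 4 \<and>
    (\<forall>n. t (n + 3) = 4 * t (n + 2) - 3 * t (n + 1) - 2 * t n)"
proof -
  let ?h = "hanoi_cost (\<lambda>m. real (pell (m + 1)))"
  have min: "is_min_cost w n k (?h n)" for n k
    by (rule is_min_cost_hanoi_cost) (use w in simp_all)
  have t_eq: "t n = ?h n" for n
    unfolding t by (rule min_cost_eqI[OF min]) (simp add: pegs_def)
  have closed: "t n = real (pell (n + 2)) - 2 ^ (n + 1)" for n
    unfolding t_eq by (rule hanoi_cost_pell)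
  have "is_min_cost w n k (t n) \<and> min_cost w n k = t n" if "k \<in> pegs" for n k
    using min min_cost_eqI[OF min that] by (simp add: t_eq)
  moreover have "t 0 = 0" "t 1 = 1" "t 2 = 4"
    unfolding closed by (simp_all add: numeral_eq_Suc)
  moreover have "t (n + 3) = 4 * t (n + 2) - 3 * t (n + 1) - 2 * t n" for n
    unfolding closed by (simp add: numeral_eq_Suc)
  ultimately show ?thesis using closed by blast
qed

end
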